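(* Let $a,b,z\in\mathbb{C}$ with $-(a+b)\notin\mathbb{N}\cup\{0\}$. Then $$F^2(a,b;a+b;z)=\sum_{n=0}^\infty u_n z^n,\qquad |z|<1,$$ with $u_0=1$, $u_1=2ab/(a+b)$ and $$u_{n+1}=\alpha_0(n)u_n+\alpha_1(n)u_{n-1},\qquad n\ge 1,$$ where $$\alpha_0(n)=\frac{(2a+2b+2n-1)\big(n^2+(2a+2b-1)n+2ab\big)}{(n+1)(a+b+n)(2(a+b)+n-1)},$$ $$\alpha_1(n)=-\frac{(2a+n-1)(2b+n-1)(a+b+n-1)}{(n+1)(a+b+n)(2(a+b)+n-1)}.$$
   Context: $F(a,b;c;z)=\sum_{k=0}^\infty \frac{(a)_k(b)_k}{(c)_k\,k!}z^k$ for $|z|<1$, $-c\notin\mathbb{N}\cup\{0\}$, is the Gaussian hypergeometric function, where $(x)_k=x(x+1)\cdots(x+k-1)$, $(x)_0=1$. $F^2(a,b;c;z)$ means $(F(a,b;c;z))^2$.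
   Formalization: The recurrence is asserted only for those n ≥ 1 with 2(a+b)+n-1 ≠ 0; when a+b = -1/2, -3/2, ... this factor vanishes at the single index n = 1-2(a+b), where α_0(n) and α_1(n) are undefined. *)

theory Defs
  imports "HOL-Complex_Analysis.Complex_Analysis"
begin

text \<open>
  Only meaningful for \<open>norm z < 1\<close> and \<open>- c \<notin> \<nat>\<close>, where \<open>0 \<in> \<nat>\<close>: then the series converges
  and no denominator vanishes.
\<close>
definition hypergeo_F :: "complex \<Rightarrow> complex \<Rightarrow> complex \<Rightarrow> complex \<Rightarrow> complex" where
  "hypergeo_F a b c z =
     (\<Sum>k. pochhammer a k * pochhammer b k / (pochhammer c k * fact k) * z ^ k)"

text \<open>
  For \<open>n \<ge> 1\<close> and \<open>- (a + b) \<notin> \<nat>\<close>, the common denominator of the two recurrence coefficients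
  vanishes iff \<open>2 * (a + b) + n - 1 = 0\<close>. This can only occur when \<open>a + b\<close> is one of
  \<open>-1/2, -3/2, -5/2, \<dots>\<close>, and then at exactly one index \<open>n\<close>. The values given there by the
  convention \<open>x / 0 = 0\<close> have no mathematical meaning.
\<close>
definition alpha0 :: "complex \<Rightarrow> complex \<Rightarrow> nat \<Rightarrow> complex" where
  "alpha0 a b n =
     (2 * a + 2 * b + 2 * of_nat n - 1) *
       ((of_nat n)^2 + (2 * a + 2 * b - 1) * of_nat n + 2 * a * b) /
     ((of_nat n + 1) * (a + b + of_nat n) * (2 * (a + b) + of_nat n - 1))"

definition alpha1 :: "complex \<Rightarrow> complex \<Rightarrow> nat \<Rightarrow> complex" where
  "alpha1 a b n =
     - ((2 * a + of_nat n - 1) * (2 * b + of_nat n - 1) * (a + b + of_nat n - 1) /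
        ((of_nat n + 1) * (a + b + of_nat n) * (2 * (a + b) + of_nat n - 1)))"

end

theory Submission
  imports Defs
begin

text \<open>
  With \<open>c = a + b\<close>, the series \<open>f = F(a,b;c;z)\<close> solves the hypergeometric equation
  \<open>z(1 - z) f'' + (c - (c + 1) z) f' - a b f = 0\<close>. The square of a solution of any linear
  equation of order two satisfies a linear equation of order three, its symmetric square. Comparing
  coefficients in that equation gives a recurrence for the coefficients of \<open>f\<^sup>2\<close>.

  For \<open>A = z(1 - z)\<close>, \<open>P = c - (c + 1) z\<close> and constant \<open>Q = - a b\<close> the symmetric square has
  coefficients \<open>A\<^sup>2\<close>, \<open>3AP\<close>, \<open>R\<close>, \<open>S\<close> with \<open>deg R \<le> 2\<close> and \<open>deg S \<le> 1\<close>, so that each of its terms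
  shifts exponents by \<open>-1\<close>, \<open>0\<close> or \<open>1\<close>: the recurrence has three terms. Its outer coefficients factor
  because they are indicial polynomials. For \<open>u\<^sub>n\<^sub>+\<^sub>1\<close> it is the one at the origin, evaluated at
  \<open>n + 1\<close>, whose roots \<open>0\<close>, \<open>1 - c\<close>, \<open>2 - 2c\<close> are the sums of two exponents of \<open>f\<close> there; for
  \<open>u\<^sub>n\<^sub>-\<^sub>1\<close> it is the one at infinity, with exponents \<open>2a\<close>, \<open>a + b\<close>, \<open>2b\<close>. The relation \<open>c = a + b\<close>
  makes the middle coefficient factor as well.

  All of this takes place in the ring of formal power series
  (\<open>hypergeo_fps_ode\<close>, \<open>fps_symmetric_square_ode\<close>, \<open>hypergeo_fps_square_recurrence\<close>); the analytic
  content is only that the series converges absolutely for \<open>norm z < 1\<close>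
  (\<open>summable_norm_hypergeo\<close>), so that the Cauchy product represents the square of its sum.
\<close>

definition hypergeo_fps :: "complex \<Rightarrow> complex \<Rightarrow> complex \<Rightarrow> complex fps" where
  "hypergeo_fps a b c =
     Abs_fps (\<lambda>k. pochhammer a k * pochhammer b k / (pochhammer c k * fact k))"

lemma add_of_nat_neq_0:
  fixes c :: complex
  assumes "- c \<notin> \<nat>"
  shows "c + of_nat n \<noteq> 0"
  using assms by (metis of_nat_in_Nats minus_unique add.commute minus_minus)

lemma hypergeo_fps_nth_Suc:
  shows "hypergeo_fps a b c $ Suc n =
           (a + of_nat n) * (b + of_nat n) / ((c + of_nat n) * (of_nat n + 1)) * hypergeo_fps a b c $ n"
  by (simp add: hypergeo_fps_def pochhammer_Suc add.commute mult_ac)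

text \<open>
  The ratio of consecutive terms tends to \<open>z\<close>. The ratio test is used in the form of an upper bound,
  since all terms vanish from some index on when \<open>- a\<close> or \<open>- b\<close> is a natural number.
\<close>
lemma summable_norm_hypergeo:
  assumes z: "norm z < 1"
  shows "summable (\<lambda>n. norm (hypergeo_fps a b c $ n * z ^ n))"
proof -
  define q where
    "q n = (a + of_nat n) * (b + of_nat n) / ((c + of_nat n) * (of_nat n + 1)) * z" for n :: nat
  have lin: "((\<lambda>n. (w + of_nat n) / of_nat n) \<longlongrightarrow> 1) sequentially" for w :: complex
  proof -
    have "(\<lambda>n. w / of_nat n + 1) \<longlonglongrightarrow> 0 + 1"
      by (intro tendsto_intros lim_const_over_n)
    moreover have "eventually (\<lambda>n. w / of_nat n + 1 = (w + of_nat n) / of_nat n) sequentially"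
      using eventually_gt_at_top[of 0] by eventually_elim (simp add: field_simps)
    ultimately show ?thesis
      by (auto intro: Lim_transform_eventually)
  qed
  have "(\<lambda>n. ((a + of_nat n) / of_nat n) * ((b + of_nat n) / of_nat n) /
             (((c + of_nat n) / of_nat n) * ((1 + of_nat n) / of_nat n)) * z) \<longlonglongrightarrow> 1 * 1 / (1 * 1) * z"
    by (intro tendsto_intros lin) auto
  moreover have "eventually (\<lambda>n. ((a + of_nat n) / of_nat n) * ((b + of_nat n) / of_nat n) /
             (((c + of_nat n) / of_nat n) * ((1 + of_nat n) / of_nat n)) * z = q n) sequentially"
    using eventually_gt_at_top[of 0] by eventually_elim (simp add: q_def add.commute)
  ultimately have "q \<longlonglongrightarrow> z"
    by (auto intro: Lim_transform_eventually)
  then have lim: "(\<lambda>n. norm (q n)) \<longlonglongrightarrow> norm z"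
    by (rule tendsto_norm)
  obtain r where r: "norm z < r" "r < 1"
    using z dense by blast
  obtain N where N: "\<And>n. n \<ge> N \<Longrightarrow> norm (q n) < r"
    using order_tendstoD(2)[OF lim r(1)] by (auto simp: eventually_sequentially)
  show ?thesis
  proof (rule summable_ratio_test[OF r(2)])
    fix n assume "n \<ge> N"
    have "hypergeo_fps a b c $ Suc n * z ^ Suc n = q n * (hypergeo_fps a b c $ n * z ^ n)"
      by (simp add: hypergeo_fps_nth_Suc q_def)
    then have "norm (hypergeo_fps a b c $ Suc n * z ^ Suc n)
                 = norm (q n) * norm (hypergeo_fps a b c $ n * z ^ n)"
      by (simp only: norm_mult)
    then show "norm (norm (hypergeo_fps a b c $ Suc n * z ^ Suc n))
                 \<le> r * norm (norm (hypergeo_fps a b c $ n * z ^ n))"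
      using N[OF \<open>n \<ge> N\<close>] by (metis less_imp_le mult_right_mono norm_ge_zero real_norm_def abs_norm_cancel)
  qed
qed

lemma hypergeo_square_sums:
  assumes "norm z < 1"
  shows "(\<lambda>n. (hypergeo_fps a b c)\<^sup>2 $ n * z ^ n) sums (hypergeo_F a b c z)\<^sup>2"
proof -
  let ?t = "\<lambda>n. hypergeo_fps a b c $ n * z ^ n"
  have "(\<lambda>n. \<Sum>i\<le>n. ?t i * ?t (n - i)) sums ((\<Sum>n. ?t n) * (\<Sum>n. ?t n))"
    by (intro Cauchy_product_sums summable_norm_hypergeo assms)
  moreover have "(\<Sum>i\<le>n. ?t i * ?t (n - i)) = (hypergeo_fps a b c)\<^sup>2 $ n * z ^ n" for n
  proof -
    have "?t i * ?t (n - i) = hypergeo_fps a b c $ i * hypergeo_fps a b c $ (n - i) * z ^ n"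
      if "i \<le> n" for i
      using that power_add[of z i "n - i"] by simp
    then have "(\<Sum>i\<le>n. ?t i * ?t (n - i))
                 = (\<Sum>i\<le>n. hypergeo_fps a b c $ i * hypergeo_fps a b c $ (n - i) * z ^ n)"
      by (intro sum.cong) auto
    then show ?thesis
      by (simp only: power2_eq_square fps_mult_nth sum_distrib_right atMost_atLeast0)
  qed
  moreover have "hypergeo_F a b c z = (\<Sum>n. ?t n)"
    by (simp add: hypergeo_F_def hypergeo_fps_def)
  ultimately show ?thesis
    by (simp add: power2_eq_square)
qed

lemma hypergeo_fps_ode:
  fixes a b c :: complex
  assumes "- c \<notin> \<nat>"
  defines "f \<equiv> hypergeo_fps a b c"
  shows "(fps_X - fps_X\<^sup>2) * fps_deriv (fps_deriv f)
         + (fps_const c - fps_const (a + b + 1) * fps_X) * fps_deriv f + fps_const (- (a * b)) * f = 0"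
proof (rule fps_ext)
  fix n
  have rec: "(c + of_nat m) * (of_nat m + 1) * f $ Suc m = (a + of_nat m) * (b + of_nat m) * f $ m" for m
  proof -
    have "of_nat m + 1 \<noteq> (0 :: complex)"
      by (metis of_nat_Suc of_nat_neq_0 add.commute)
    then show ?thesis
      unfolding f_def hypergeo_fps_nth_Suc
      using add_of_nat_neq_0[OF assms(1), of m] by simp
  qed
  consider "n = 0" | "n = 1" | m where "n = Suc (Suc m)"
    by (metis One_nat_def not0_implies_Suc)
  then show "((fps_X - fps_X\<^sup>2) * fps_deriv (fps_deriv f)
      + (fps_const c - fps_const (a + b + 1) * fps_X) * fps_deriv f + fps_const (- (a * b)) * f) $ n = 0 $ n"
    by cases
      (use rec[of n] in \<open>simp_all add: ring_distribs mult.assoc fps_X_power_mult_nth,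
        (simp add: algebra_simps eval_nat_numeral)+\<close>)
qed

text \<open>
  Write \<open>E = 0\<close> for the given equation. The left-hand side of the conclusion is the combination
  \<open>2Af E' + (6Af' + (4P - 2A')f) E\<close>: the first summand matches the third derivative of \<open>f\<close>, and
  \<open>f'f''\<close> and \<open>ff''\<close> then determine the multiplier of \<open>E\<close>. Multiplication by \<open>A\<close> avoids
  any division by the leading coefficient.
\<close>
lemma fps_symmetric_square_ode:
  fixes A P Q f :: "'a::comm_ring_1 fps"
  assumes "A * fps_deriv (fps_deriv f) + P * fps_deriv f + Q * f = 0"
  defines "g \<equiv> f\<^sup>2"
  shows "A\<^sup>2 * fps_deriv (fps_deriv (fps_deriv g)) + 3 * A * P * fps_deriv (fps_deriv g)
         + (2 * P\<^sup>2 + A * fps_deriv P - fps_deriv A * P + 4 * A * Q) * fps_deriv g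
         + (4 * P * Q + 2 * (A * fps_deriv Q - fps_deriv A * Q)) * g = 0" (is "?lhs = 0")
proof -
  let ?E = "A * fps_deriv (fps_deriv f) + P * fps_deriv f + Q * f"
  have "?lhs = 2 * A * f * fps_deriv ?E + (6 * A * fps_deriv f + (4 * P - 2 * fps_deriv A) * f) * ?E"
    by (simp add: g_def power2_eq_square algebra_simps)
  then show ?thesis
    unfolding assms(1) by simp
qed

text \<open>
  The recurrence in a form cleared of denominators. It is the coefficient of \<open>z\<^sup>n\<close> in the
  symmetric square of the hypergeometric equation.
\<close>
lemma hypergeo_fps_square_recurrence:
  fixes a b c :: complex
  assumes "- c \<notin> \<nat>" and "c = a + b" and "n \<ge> 1"
  defines "g \<equiv> (hypergeo_fps a b c)\<^sup>2"
  shows "(of_nat n + 1) * (c + of_nat n) * (2 * c + of_nat n - 1) * g $ (n + 1) =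
           (2 * c + 2 * of_nat n - 1) * ((of_nat n)\<^sup>2 + (2 * c - 1) * of_nat n + 2 * a * b) * g $ n
           - (2 * a + of_nat n - 1) * (2 * b + of_nat n - 1) * (c + of_nat n - 1) * g $ (n - 1)"
proof -
  define K where "K = a * b"
  let ?A = "fps_X - fps_X\<^sup>2 :: complex fps"
  let ?P = "fps_const c - fps_const (c + 1) * fps_X"
  let ?Q = "fps_const (- K)"
  let ?D = fps_deriv
  have ode: "?A * ?D (?D (hypergeo_fps a b c)) + ?P * ?D (hypergeo_fps a b c) + ?Q * hypergeo_fps a b c = 0"
    using hypergeo_fps_ode[OF assms(1), of a b] by (simp add: assms(2) K_def)
  have "fps_X\<^sup>2 * ?D (?D (?D g)) - fps_const 2 * (fps_X ^ 3 * ?D (?D (?D g))) + fps_X ^ 4 * ?D (?D (?D g))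
      + fps_const (3 * c) * (fps_X * ?D (?D g)) - fps_const (3 * (2 * c + 1)) * (fps_X\<^sup>2 * ?D (?D g))
      + fps_const (3 * (c + 1)) * (fps_X ^ 3 * ?D (?D g))
      + fps_const (2 * c\<^sup>2 - c) * ?D g - fps_const (4 * c\<^sup>2 + 2 * c + 4 * K) * (fps_X * ?D g)
      + fps_const (2 * c\<^sup>2 + 3 * c + 1 + 4 * K) * (fps_X\<^sup>2 * ?D g)
      + fps_const (2 * K * (1 - 2 * c)) * g + fps_const (4 * K * c) * (fps_X * g) = 0" (is "?L = 0")
  proof -
    \<comment> \<open>Constants are named so that \<open>algebra_simps\<close> sees a polynomial identity in \<open>C\<close>, \<open>k\<close> and \<open>fps_X\<close>.\<close>
    define C where "C = fps_const c"
    define k where "k = fps_const K"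
    have coeff_eqs: "fps_const (3 * c) = 3 * C" "fps_const (3 * (2 * c + 1)) = 3 * (2 * C + 1)"
      "fps_const (3 * (c + 1)) = 3 * (C + 1)" "fps_const (2 * c\<^sup>2 - c) = 2 * C\<^sup>2 - C"
      "fps_const (4 * c\<^sup>2 + 2 * c + 4 * K) = 4 * C\<^sup>2 + 2 * C + 4 * k"
      "fps_const (2 * c\<^sup>2 + 3 * c + 1 + 4 * K) = 2 * C\<^sup>2 + 3 * C + 1 + 4 * k"
      "fps_const (2 * K * (1 - 2 * c)) = 2 * k * (1 - 2 * C)" "fps_const (4 * K * c) = 4 * k * C"
      "fps_const (c + 1) = C + 1" "fps_const c = C" "fps_const (- K) = - k" "fps_const 2 = (2 :: complex fps)"
      by (simp_all add: C_def k_def numeral_fps_const fps_const_power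
            flip: fps_const_add fps_const_mult fps_const_sub fps_const_neg fps_const_1_eq_1)
    have der: "?D C = 0" "?D k = 0" "?D (fps_X\<^sup>2) = 2 * (fps_X :: complex fps)"
      by (simp_all add: C_def k_def power2_eq_square)
    show ?thesis
      using fps_symmetric_square_ode[OF ode, folded g_def] unfolding coeff_eqs
      by (simp add: der algebra_simps power2_eq_square power3_eq_cube power4_eq_xxxx)
  qed
  then have "?L $ n = 0"
    by simp
  \<comment> \<open>At small \<open>n\<close>, where the shift by a power of \<open>fps_X\<close> gives the coefficient zero, the polynomial
    in \<open>n\<close> vanishes too; this is why no case distinction remains.\<close>
  moreover have
    "(fps_X\<^sup>2 * ?D (?D (?D g))) $ n = (of_nat n + 1) * of_nat n * (of_nat n - 1) * g $ (n + 1)"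
    "(fps_X ^ 3 * ?D (?D (?D g))) $ n = of_nat n * (of_nat n - 1) * (of_nat n - 2) * g $ n"
    "(fps_X ^ 4 * ?D (?D (?D g))) $ n = (of_nat n - 1) * (of_nat n - 2) * (of_nat n - 3) * g $ (n - 1)"
    "(fps_X * ?D (?D g)) $ n = (of_nat n + 1) * of_nat n * g $ (n + 1)"
    "(fps_X\<^sup>2 * ?D (?D g)) $ n = of_nat n * (of_nat n - 1) * g $ n"
    "(fps_X ^ 3 * ?D (?D g)) $ n = (of_nat n - 1) * (of_nat n - 2) * g $ (n - 1)"
    "?D g $ n = (of_nat n + 1) * g $ (n + 1)"
    "(fps_X * ?D g) $ n = of_nat n * g $ n"
    "(fps_X\<^sup>2 * ?D g) $ n = (of_nat n - 1) * g $ (n - 1)"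
    "(fps_X * g) $ n = g $ (n - 1)"
  proof -
    consider "n = 1" | "n = 2" | "n = 3" | m where "n = m + 4"
      using assms(3) nat_le_iff_add[of 4 n] by (cases "n \<ge> 4") (auto simp: add.commute, force)
    note n_cases = this
    show "(fps_X\<^sup>2 * ?D (?D (?D g))) $ n = (of_nat n + 1) * of_nat n * (of_nat n - 1) * g $ (n + 1)"
      by (rule n_cases) (simp_all add: fps_X_power_mult_nth eval_nat_numeral algebra_simps)
    show "(fps_X ^ 3 * ?D (?D (?D g))) $ n = of_nat n * (of_nat n - 1) * (of_nat n - 2) * g $ n"
      by (rule n_cases) (simp_all add: fps_X_power_mult_nth eval_nat_numeral algebra_simps)
    show "(fps_X ^ 4 * ?D (?D (?D g))) $ n = (of_nat n - 1) * (of_nat n - 2) * (of_nat n - 3) * g $ (n - 1)"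
      by (rule n_cases) (simp_all add: fps_X_power_mult_nth eval_nat_numeral algebra_simps)
    show "(fps_X * ?D (?D g)) $ n = (of_nat n + 1) * of_nat n * g $ (n + 1)"
      by (rule n_cases) (simp_all add: eval_nat_numeral algebra_simps)
    show "(fps_X\<^sup>2 * ?D (?D g)) $ n = of_nat n * (of_nat n - 1) * g $ n"
      by (rule n_cases) (simp_all add: fps_X_power_mult_nth eval_nat_numeral algebra_simps)
    show "(fps_X ^ 3 * ?D (?D g)) $ n = (of_nat n - 1) * (of_nat n - 2) * g $ (n - 1)"
      by (rule n_cases) (simp_all add: fps_X_power_mult_nth eval_nat_numeral algebra_simps)
    show "?D g $ n = (of_nat n + 1) * g $ (n + 1)"
      by simp
    show "(fps_X * ?D g) $ n = of_nat n * g $ n"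
      by (rule n_cases) (simp_all add: eval_nat_numeral algebra_simps)
    show "(fps_X\<^sup>2 * ?D g) $ n = (of_nat n - 1) * g $ (n - 1)"
      by (rule n_cases) (simp_all add: fps_X_power_mult_nth eval_nat_numeral algebra_simps)
    show "(fps_X * g) $ n = g $ (n - 1)"
      using assms(3) by simp
  qed
  ultimately show ?thesis
    unfolding fps_add_nth fps_sub_nth fps_mult_left_const_nth K_def assms(2) by algebra
qed

theorem corollary2p1:
  fixes a b :: complex
  assumes "- (a + b) \<notin> \<nat>"
  shows "\<exists>u :: nat \<Rightarrow> complex.
           u 0 = 1 \<and>
           u 1 = 2 * a * b / (a + b) \<and>
           (\<forall>n\<ge>1. 2 * (a + b) + of_nat n - 1 \<noteq> 0 \<longrightarrow>
              u (n + 1) = alpha0 a b n * u n + alpha1 a b n * u (n - 1)) \<and>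
           (\<forall>z :: complex. norm z < 1 \<longrightarrow>
              (\<lambda>n. u n * z ^ n) sums (hypergeo_F a b (a + b) z)\<^sup>2)"
proof -
  define u where "u n = (hypergeo_fps a b (a + b))\<^sup>2 $ n" for n
  have "u 0 = 1" and "u 1 = 2 * a * b / (a + b)"
    by (simp_all add: u_def power2_eq_square fps_mult_nth hypergeo_fps_def)
  moreover have "u (n + 1) = alpha0 a b n * u n + alpha1 a b n * u (n - 1)"
    if n: "n \<ge> 1" and nz: "2 * (a + b) + of_nat n - 1 \<noteq> 0" for n
  proof -
    let ?d = "(of_nat n + 1) * (a + b + of_nat n) * (2 * (a + b) + of_nat n - 1)"
    have "of_nat n + 1 \<noteq> (0 :: complex)"
      by (metis of_nat_Suc of_nat_neq_0 add.commute)
    then have "?d \<noteq> 0"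
      using nz add_of_nat_neq_0[OF assms, of n] by simp
    moreover have "?d * u (n + 1) =
        (2 * a + 2 * b + 2 * of_nat n - 1) * ((of_nat n)\<^sup>2 + (2 * a + 2 * b - 1) * of_nat n + 2 * a * b) * u n
        - (2 * a + of_nat n - 1) * (2 * b + of_nat n - 1) * (a + b + of_nat n - 1) * u (n - 1)"
      using hypergeo_fps_square_recurrence[OF assms refl n] by (simp add: u_def distrib_left)
    ultimately have "u (n + 1) =
        ((2 * a + 2 * b + 2 * of_nat n - 1) * ((of_nat n)\<^sup>2 + (2 * a + 2 * b - 1) * of_nat n + 2 * a * b) * u n
        - (2 * a + of_nat n - 1) * (2 * b + of_nat n - 1) * (a + b + of_nat n - 1) * u (n - 1)) / ?d"
      by (metis nonzero_mult_div_cancel_left)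
    then show ?thesis
      by (simp add: alpha0_def alpha1_def diff_divide_distrib)
  qed
  moreover have "(\<lambda>n. u n * z ^ n) sums (hypergeo_F a b (a + b) z)\<^sup>2" if "norm z < 1" for z
    using hypergeo_square_sums[OF that] by (simp add: u_def)
  ultimately show ?thesis
    by blast
qed

end
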